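(* There exist sequences of (possibly partial) functions $F_n:D_n\to\{0,1\}$ with $D_n\subseteq\{0,1\}^n\times\{0,1\}^n$ (possibly different for the three items) showing that each of the following inequalities is exponentially weak, in the sense that the right-hand side $R(F_n)$ tends to infinity while the left-hand side satisfies $L(F_n)=O(\log R(F_n))$: (i) $\mathsf{QNM}^{\rightarrow}(F)\le \mathsf{NM}^{\rightarrow}(F)$; (ii) $\mathsf{QM}^{\rightarrow}(F)\le \mathsf{M}^{\rightarrow}(F)$; (iii) $\mathsf{QM}(F)\le\mathsf{M}(F)$.
   Context: Alice holds $x$, Bob holds $y$, $(x,y)\in D_n$; protocols need only be correct on $D_n$. Complexity is the maximum message length in (qu)bits, minimized over correct protocols. Classical models: $\mathsf{M}(F)$: two-way; Alice's $s$-bit messages may depend on $x$ and the entire history; Bob has no memory and replies to a message $m$ with $g_y(m)\in\{0,1\}^s$; termination when a message $1^{s-1}b$ is sent, output $b$. $\mathsf{M}^{\rightarrow}(F)$: one-way; Alice (with memory) sends a sequence of $s$-bit messages depending on $x$ and her previous messages; Bob, memoryless, on each message $m$ computes $g_y(m)\in\{0,1,\perp\}$, outputs and stops if it is $0/1$, continues on $\perp$. $\mathsf{NM}^{\rightarrow}(F)$: as $\mathsf{M}^{\rightarrow}$ but Alice has no memory, so each message depends only on $x$. Classical protocols must always output $F(x,y)$. Quantum models: the same models, except that messages are $m$-qubit quantum states, parties may apply arbitrary quantum operations (including measurements) to the received message together with fresh ancillas, and a memoryless party discards all of its private registers after each round (its action depends only on its input and the current message); a party with memory may keep arbitrary classical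 and quantum information between rounds. $\mathsf{QNM}^{\rightarrow}$, $\mathsf{QM}^{\rightarrow}$, $\mathsf{QM}$ are the quantum analogues of $\mathsf{NM}^{\rightarrow}$, $\mathsf{M}^{\rightarrow}$, $\mathsf{M}$ respectively, and a quantum protocol computes $F$ if for every $(x,y)\in D_n$ it outputs $F(x,y)$ with probability at least $2/3$. *)

theory Defs
  imports
    Complex_Main
    "HOL-Library.Landau_Symbols"
    "Jordan_Normal_Form.Schur_Decomposition"
begin

text \<open>A partial function is a pair of a domain \<open>D\<close> and a total function \<open>F\<close>; every notion
  below looks at \<open>F\<close> on \<open>D\<close> only.\<close>

type_synonym bits = "bool list"
type_synonym complexity = "(bits \<times> bits) set \<Rightarrow> (bits \<Rightarrow> bits \<Rightarrow> bool) \<Rightarrow> nat"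


section \<open>Classical models\<close>

subsection \<open>One-way\<close>

text \<open>Alice's strategy \<open>a\<close> (her input already supplied) maps the list of her previous messages
  to the next one; in Bob's \<open>g\<close> the value \<open>None\<close> stands for the symbol ``continue''.\<close>

primrec oneway_history :: "(bits list \<Rightarrow> bits) \<Rightarrow> nat \<Rightarrow> bits list" where
  "oneway_history a 0 = []"
| "oneway_history a (Suc t) = oneway_history a t @ [a (oneway_history a t)]"

definition oneway_message :: "(bits list \<Rightarrow> bits) \<Rightarrow> nat \<Rightarrow> bits" where
  "oneway_message a t = a (oneway_history a t)"

definition oneway_outputs :: "(bits list \<Rightarrow> bits) \<Rightarrow> (bits \<Rightarrow> bool option) \<Rightarrow> bool \<Rightarrow> bool" where
  "oneway_outputs a g b \<longleftrightarrow>
     (\<exists>t. g (oneway_message a t) = Some b \<and> (\<forall>u<t. g (oneway_message a u) = None))"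

definition M_oneway_computable ::
  "nat \<Rightarrow> (bits \<times> bits) set \<Rightarrow> (bits \<Rightarrow> bits \<Rightarrow> bool) \<Rightarrow> bool" where
  "M_oneway_computable s D F \<longleftrightarrow>
     (\<exists>(A :: bits \<Rightarrow> bits list \<Rightarrow> bits) (g :: bits \<Rightarrow> bits \<Rightarrow> bool option).
        (\<forall>x h. length (A x h) = s) \<and>
        (\<forall>(x, y)\<in>D. oneway_outputs (A x) (g y) (F x y)))"

definition NM_oneway_computable ::
  "nat \<Rightarrow> (bits \<times> bits) set \<Rightarrow> (bits \<Rightarrow> bits \<Rightarrow> bool) \<Rightarrow> bool" where
  "NM_oneway_computable s D F \<longleftrightarrow>
     (\<exists>(A :: bits \<Rightarrow> bits) (g :: bits \<Rightarrow> bits \<Rightarrow> bool option).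
        (\<forall>x. length (A x) = s) \<and>
        (\<forall>(x, y)\<in>D. oneway_outputs (\<lambda>h. A x) (g y) (F x y)))"

definition M_oneway :: complexity where
  "M_oneway D F = (LEAST s. M_oneway_computable s D F)"

definition NM_oneway :: complexity where
  "NM_oneway D F = (LEAST s. NM_oneway_computable s D F)"

subsection \<open>Two-way\<close>

text \<open>Messages are numbered \<open>0, 1, 2, \<dots>\<close>; the even ones are Alice's, the odd ones Bob's replies.
  The sequence is continued past a terminating message, which has no effect on the output.\<close>

primrec twoway_history :: "(bits list \<Rightarrow> bits) \<Rightarrow> (bits \<Rightarrow> bits) \<Rightarrow> nat \<Rightarrow> bits list" where
  "twoway_history a g 0 = []"
| "twoway_history a g (Suc k) =
     twoway_history a g k @
       [if even k then a (twoway_history a g k) else g (last (twoway_history a g k))]"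

definition twoway_message :: "(bits list \<Rightarrow> bits) \<Rightarrow> (bits \<Rightarrow> bits) \<Rightarrow> nat \<Rightarrow> bits" where
  "twoway_message a g k = last (twoway_history a g (Suc k))"

definition stop_message :: "nat \<Rightarrow> bool \<Rightarrow> bits" where
  "stop_message s b = replicate (s - 1) True @ [b]"

definition twoway_outputs ::
  "nat \<Rightarrow> (bits list \<Rightarrow> bits) \<Rightarrow> (bits \<Rightarrow> bits) \<Rightarrow> bool \<Rightarrow> bool" where
  "twoway_outputs s a g b \<longleftrightarrow>
     (\<exists>k. twoway_message a g k = stop_message s b \<and>
          (\<forall>j<k. \<forall>c. twoway_message a g j \<noteq> stop_message s c))"

definition M_twoway_computable ::
  "nat \<Rightarrow> (bits \<times> bits) set \<Rightarrow> (bits \<Rightarrow> bits \<Rightarrow> bool) \<Rightarrow> bool" where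
  "M_twoway_computable s D F \<longleftrightarrow> s \<ge> 1 \<and>
     (\<exists>(A :: bits \<Rightarrow> bits list \<Rightarrow> bits) (g :: bits \<Rightarrow> bits \<Rightarrow> bits).
        (\<forall>x h. length (A x h) = s) \<and> (\<forall>y m. length m = s \<longrightarrow> length (g y m) = s) \<and>
        (\<forall>(x, y)\<in>D. twoway_outputs s (A x) (g y) (F x y)))"

definition M_twoway :: complexity where
  "M_twoway D F = (LEAST s. M_twoway_computable s D F)"


section \<open>Quantum operations\<close>

definition mat_trace :: "complex mat \<Rightarrow> complex" where
  "mat_trace A = (\<Sum>i<dim_row A. A $$ (i, i))"

definition kron :: "complex mat \<Rightarrow> complex mat \<Rightarrow> complex mat" where
  "kron A B = mat (dim_row A * dim_row B) (dim_col A * dim_col B)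
     (\<lambda>(i, j). A $$ (i div dim_row B, j div dim_col B) * B $$ (i mod dim_row B, j mod dim_col B))"

text \<open>Quantum operations from a \<open>c\<close>-dimensional to an \<open>r\<close>-dimensional system are given by lists of
  Kraus operators. The dimension \<open>r\<close> is passed explicitly only to fix the value of empty sums.\<close>

definition apply_op :: "nat \<Rightarrow> complex mat list \<Rightarrow> complex mat \<Rightarrow> complex mat" where
  "apply_op r Ks \<rho> = foldr (+) (map (\<lambda>K. K * \<rho> * mat_adjoint K) Ks) (0\<^sub>m r r)"

definition quantum_channel :: "nat \<Rightarrow> nat \<Rightarrow> complex mat list \<Rightarrow> bool" where
  "quantum_channel c r Ks \<longleftrightarrow>
     set Ks \<subseteq> carrier_mat r c \<and>
     foldr (+) (map (\<lambda>K. mat_adjoint K * K) Ks) (0\<^sub>m c c) = 1\<^sub>m c"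

text \<open>The operation \<open>Ks\<close> on the second factor of a composite system whose first factor has
  dimension \<open>d\<close>.\<close>

definition on_message :: "nat \<Rightarrow> complex mat list \<Rightarrow> complex mat list" where
  "on_message d Ks = map (kron (1\<^sub>m d)) Ks"


section \<open>Quantum models\<close>

text \<open>The joint state of Alice's memory and the \<open>m\<close>-qubit message lives on a space of dimension
  \<open>d t * 2 ^ m\<close>, where \<open>d t\<close> is the (finite, but not a priori bounded) dimension of the memory kept
  after Alice's operation number \<open>t\<close>. Measurement outcomes and other classical information that
  Alice wants to keep are part of that memory, so each of her operations is a channel. All states
  are subnormalised: their trace is the probability that the protocol has not stopped before.\<close>

subsection \<open>One-way\<close>

text \<open>Alice's operation 0 acts on the one-dimensional system, i.e. on fresh ancillas only;
  afterwards she acts on the memory she kept.\<close>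

definition oneway_alice :: "nat \<Rightarrow> (nat \<Rightarrow> nat) \<Rightarrow> (nat \<Rightarrow> complex mat list) \<Rightarrow> bool" where
  "oneway_alice m d A \<longleftrightarrow> quantum_channel 1 (d 0 * 2 ^ m) (A 0) \<and>
     (\<forall>t. quantum_channel (d t) (d (Suc t) * 2 ^ m) (A (Suc t)))"

text \<open>Bob performs a measurement with outcomes \<open>Some False\<close>, \<open>Some True\<close>, \<open>None\<close>, where \<open>None\<close> means
  ``continue''. He keeps nothing, hence the output dimension 1 of the Kraus operators.\<close>

definition oneway_bob :: "nat \<Rightarrow> (bool option \<Rightarrow> complex mat list) \<Rightarrow> bool" where
  "oneway_bob m B \<longleftrightarrow>
     quantum_channel (2 ^ m) 1 (B None @ B (Some False) @ B (Some True))"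

primrec oneway_state :: "nat \<Rightarrow> (nat \<Rightarrow> nat) \<Rightarrow> (nat \<Rightarrow> complex mat list) \<Rightarrow>
    (bool option \<Rightarrow> complex mat list) \<Rightarrow> nat \<Rightarrow> complex mat" where
  "oneway_state m d A B 0 = apply_op (d 0 * 2 ^ m) (A 0) (1\<^sub>m 1)"
| "oneway_state m d A B (Suc t) = apply_op (d (Suc t) * 2 ^ m) (A (Suc t))
     (apply_op (d t) (on_message (d t) (B None)) (oneway_state m d A B t))"

definition oneway_stop_prob :: "nat \<Rightarrow> (nat \<Rightarrow> nat) \<Rightarrow> (nat \<Rightarrow> complex mat list) \<Rightarrow>
    (bool option \<Rightarrow> complex mat list) \<Rightarrow> bool \<Rightarrow> nat \<Rightarrow> real" where
  "oneway_stop_prob m d A B b t =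
     Re (mat_trace (apply_op (d t) (on_message (d t) (B (Some b))) (oneway_state m d A B t)))"

definition QM_oneway_computable ::
  "nat \<Rightarrow> (bits \<times> bits) set \<Rightarrow> (bits \<Rightarrow> bits \<Rightarrow> bool) \<Rightarrow> bool" where
  "QM_oneway_computable m D F \<longleftrightarrow>
     (\<exists>(d :: bits \<Rightarrow> nat \<Rightarrow> nat) (A :: bits \<Rightarrow> nat \<Rightarrow> complex mat list)
        (B :: bits \<Rightarrow> bool option \<Rightarrow> complex mat list).
        (\<forall>x. oneway_alice m (d x) (A x)) \<and> (\<forall>y. oneway_bob m (B y)) \<and>
        (\<forall>(x, y)\<in>D. \<exists>p\<ge>2/3. oneway_stop_prob m (d x) (A x) (B y) (F x y) sums p))"

text \<open>Without memory, Alice prepares every message in the same way from fresh ancillas; this is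
  the previous model with one-dimensional memory and an operation independent of the round.\<close>

definition QNM_oneway_computable ::
  "nat \<Rightarrow> (bits \<times> bits) set \<Rightarrow> (bits \<Rightarrow> bits \<Rightarrow> bool) \<Rightarrow> bool" where
  "QNM_oneway_computable m D F \<longleftrightarrow>
     (\<exists>(A :: bits \<Rightarrow> complex mat list) (B :: bits \<Rightarrow> bool option \<Rightarrow> complex mat list).
        (\<forall>x. quantum_channel 1 (2 ^ m) (A x)) \<and> (\<forall>y. oneway_bob m (B y)) \<and>
        (\<forall>(x, y)\<in>D. \<exists>p\<ge>2/3.
           oneway_stop_prob m (\<lambda>t. 1) (\<lambda>t. A x) (B y) (F x y) sums p))"

definition QM_oneway :: complexity where
  "QM_oneway D F = (LEAST m. QM_oneway_computable m D F)"

definition QNM_oneway :: complexity where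
  "QNM_oneway D F = (LEAST m. QNM_oneway_computable m D F)"

subsection \<open>Two-way\<close>

text \<open>As in the classical model, the protocol stops with output \<open>b\<close> when the message \<open>1\<dots>1b\<close> is
  sent: every message sent is subjected to the projective measurement onto the basis states
  \<open>1\<dots>10\<close> and \<open>1\<dots>11\<close> (numbers \<open>2 ^ m - 2\<close> and \<open>2 ^ m - 1\<close> for \<open>m \<ge> 1\<close>) and onto the span of the
  remaining basis states.\<close>

definition stop_proj :: "nat \<Rightarrow> bool \<Rightarrow> complex mat" where
  "stop_proj m b = mat (2 ^ m) (2 ^ m)
     (\<lambda>(i, j). if i = j \<and> i = 2 ^ m - 2 + of_bool b then 1 else 0)"

definition continue_proj :: "nat \<Rightarrow> complex mat" where
  "continue_proj m = mat (2 ^ m) (2 ^ m) (\<lambda>(i, j). if i = j \<and> i < 2 ^ m - 2 then 1 else 0)"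

text \<open>After her first message Alice acts on her memory together with Bob's reply.\<close>

definition twoway_alice :: "nat \<Rightarrow> (nat \<Rightarrow> nat) \<Rightarrow> (nat \<Rightarrow> complex mat list) \<Rightarrow> bool" where
  "twoway_alice m d A \<longleftrightarrow> quantum_channel 1 (d 0 * 2 ^ m) (A 0) \<and>
     (\<forall>t. quantum_channel (d t * 2 ^ m) (d (Suc t) * 2 ^ m) (A (Suc t)))"

definition twoway_continue :: "nat \<Rightarrow> nat \<Rightarrow> complex mat \<Rightarrow> complex mat" where
  "twoway_continue m e \<sigma> = apply_op (e * 2 ^ m) (on_message e [continue_proj m]) \<sigma>"

text \<open>\<open>twoway_state m d A B k\<close> is the state when message number \<open>k\<close> has been sent (by Alice for even
  \<open>k\<close>, by Bob for odd \<open>k\<close>) but not yet tested; Alice's memory then has dimension \<open>d (k div 2)\<close>.\<close>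

primrec twoway_state :: "nat \<Rightarrow> (nat \<Rightarrow> nat) \<Rightarrow> (nat \<Rightarrow> complex mat list) \<Rightarrow>
    complex mat list \<Rightarrow> nat \<Rightarrow> complex mat" where
  "twoway_state m d A B 0 = apply_op (d 0 * 2 ^ m) (A 0) (1\<^sub>m 1)"
| "twoway_state m d A B (Suc k) =
     apply_op (d (Suc k div 2) * 2 ^ m)
       (if even k then on_message (d (k div 2)) B else A (Suc k div 2))
       (twoway_continue m (d (k div 2)) (twoway_state m d A B k))"

definition twoway_stop_prob :: "nat \<Rightarrow> (nat \<Rightarrow> nat) \<Rightarrow> (nat \<Rightarrow> complex mat list) \<Rightarrow>
    complex mat list \<Rightarrow> bool \<Rightarrow> nat \<Rightarrow> real" where
  "twoway_stop_prob m d A B b k =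
     Re (mat_trace (apply_op (d (k div 2) * 2 ^ m) (on_message (d (k div 2)) [stop_proj m b])
       (twoway_state m d A B k)))"

definition QM_twoway_computable ::
  "nat \<Rightarrow> (bits \<times> bits) set \<Rightarrow> (bits \<Rightarrow> bits \<Rightarrow> bool) \<Rightarrow> bool" where
  "QM_twoway_computable m D F \<longleftrightarrow> m \<ge> 1 \<and>
     (\<exists>(d :: bits \<Rightarrow> nat \<Rightarrow> nat) (A :: bits \<Rightarrow> nat \<Rightarrow> complex mat list)
        (B :: bits \<Rightarrow> complex mat list).
        (\<forall>x. twoway_alice m (d x) (A x)) \<and> (\<forall>y. quantum_channel (2 ^ m) (2 ^ m) (B y)) \<and>
        (\<forall>(x, y)\<in>D. \<exists>p\<ge>2/3. twoway_stop_prob m (d x) (A x) (B y) (F x y) sums p))"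

definition QM_twoway :: complexity where
  "QM_twoway D F = (LEAST m. QM_twoway_computable m D F)"


section \<open>Exponentially weak inequalities\<close>

definition exponentially_weak :: "complexity \<Rightarrow> complexity \<Rightarrow> bool" where
  "exponentially_weak L R \<longleftrightarrow>
     (\<exists>(D :: nat \<Rightarrow> (bits \<times> bits) set) (F :: nat \<Rightarrow> bits \<Rightarrow> bits \<Rightarrow> bool).
        (\<forall>n. D n \<subseteq> {x. length x = n} \<times> {y. length y = n}) \<and>
        filterlim (\<lambda>n. R (D n) (F n)) at_top sequentially \<and>
        (\<lambda>n. real (L (D n) (F n))) \<in> O[sequentially](\<lambda>n. ln (real (R (D n) (F n)))))"

end

theory Submission
  imports Defs "HOL-Library.Countable" "HOL-Library.FuncSet"
begin

text \<open>
  The separating function is the comparison of two \<open>n\<close>-bit strings with respect to an injective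
  numbering, so that its \<open>2 ^ n\<close> rows are distinct, and so are its columns. A memoryless classical
  Alice must therefore send distinct messages for distinct inputs, and the reply table of a
  memoryless classical Bob determines his input; as there are few tables with short messages, all
  three classical complexities tend to infinity.

  A constant number of qubits suffices, even without coherence. Alice sends the bit 1 with odds
  \<open>4 ^ a\<close>, afresh in every round. Bob answers False to a 0; to a 1 he answers True with probability
  \<open>1 / (2 * 4 ^ b)\<close> and otherwise waits. The odds of True against False are \<open>4 ^ a / (2 * 4 ^ b)\<close>,
  which is at least 2 if \<open>b < a\<close> and at most \<open>1/2\<close> otherwise.
\<close>

section \<open>Lower bounds for the classical models\<close>

text \<open>Any injective numbering will do. The lower bounds use only irreflexivity and totality on
  distinct strings, and the quantum protocols may run for any number of rounds, so large values of
  \<open>to_nat\<close> cost no qubits.\<close>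

definition exceeds :: "bits \<Rightarrow> bits \<Rightarrow> bool" where
  "exceeds x y \<longleftrightarrow> to_nat y < to_nat x"

definition input_pairs :: "nat \<Rightarrow> (bits \<times> bits) set" where
  "input_pairs n = {x. length x = n} \<times> {y. length y = n}"

lemma exceeds_irrefl: "\<not> exceeds x x"
  by (simp add: exceeds_def)

lemma exceeds_linear: "x \<noteq> y \<Longrightarrow> exceeds x y \<or> exceeds y x"
  unfolding exceeds_def by (metis linorder_neqE_nat from_nat_to_nat)

lemma card_bits: "card {x :: bits. length x = n} = 2 ^ n"
  using card_lists_length_eq[of "UNIV :: bool set" n] by simp

lemma finite_bits: "finite {x :: bits. length x = n}"
  using finite_lists_length_eq[of "UNIV :: bool set" n] by simp

section \<open>Determinacy of the output and its dependence on Bob's reply table\<close>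

lemma oneway_outputs_unique:
  assumes "oneway_outputs a g b" "oneway_outputs a g c"
  shows "b = c"
proof -
  obtain t u where "g (oneway_message a t) = Some b" "\<forall>i<t. g (oneway_message a i) = None"
    "g (oneway_message a u) = Some c" "\<forall>i<u. g (oneway_message a i) = None"
    using assms unfolding oneway_outputs_def by blast
  then show ?thesis
    by (cases t u rule: linorder_cases) auto
qed

lemma twoway_outputs_unique:
  assumes "twoway_outputs s a g b" "twoway_outputs s a g c"
  shows "b = c"
proof -
  obtain t u where "twoway_message a g t = stop_message s b"
    "\<forall>j<t. \<forall>c. twoway_message a g j \<noteq> stop_message s c"
    "twoway_message a g u = stop_message s c"
    "\<forall>j<u. \<forall>c. twoway_message a g j \<noteq> stop_message s c"
    using assms unfolding twoway_outputs_def by blast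
  then show ?thesis
    by (cases t u rule: linorder_cases) (auto simp: stop_message_def)
qed

lemma oneway_outputs_cong:
  assumes "\<And>h. length (a h) = s" and "\<And>m. length m = s \<Longrightarrow> g m = g' m"
  shows "oneway_outputs a g b \<longleftrightarrow> oneway_outputs a g' b"
  using assms by (simp add: oneway_outputs_def oneway_message_def)

text \<open>The length claim strengthens the induction: Bob replies to the last message, and
  \<open>g\<close> and \<open>g'\<close> are known to agree only on messages of length
  \<open>s\<close>. At \<open>k = 0\<close> there is no last message.\<close>

lemma twoway_history_cong:
  assumes a: "\<And>h. length (a h) = s" and g: "\<And>m. length m = s \<Longrightarrow> length (g m) = s"
    and eq: "\<And>m. length m = s \<Longrightarrow> g m = g' m"
  shows "twoway_history a g k = twoway_history a g' k \<and>
    (k > 0 \<longrightarrow> length (last (twoway_history a g k)) = s)"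
proof (induction k)
  case (Suc k)
  then show ?case
    using a g eq by (cases "even k") (auto elim: oddE)
qed simp

lemma twoway_outputs_cong:
  assumes "\<And>h. length (a h) = s" and "\<And>m. length m = s \<Longrightarrow> length (g m) = s"
    and "\<And>m. length m = s \<Longrightarrow> g m = g' m"
  shows "twoway_outputs s a g b \<longleftrightarrow> twoway_outputs s a g' b"
proof -
  have "twoway_message a g k = twoway_message a g' k" for k
    using twoway_history_cong[of a s g g' "Suc k", OF assms] by (simp only: twoway_message_def)
  then show ?thesis
    by (simp add: twoway_outputs_def)
qed

section \<open>Counting messages and reply tables\<close>

lemma NM_oneway_lower_bound:
  assumes "NM_oneway_computable s (input_pairs n) exceeds"
  shows "n \<le> s"
proof -
  obtain A g where A: "\<And>x. length (A x) = s"
    and out: "\<And>x y. (x, y) \<in> input_pairs n \<Longrightarrow> oneway_outputs (\<lambda>h. A x) (g y) (exceeds x y)"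
    using assms unfolding NM_oneway_computable_def by blast
  have eq: "exceeds x z = exceeds y z"
    if "A x = A y" "length x = n" "length y = n" "length z = n" for x y z
    using oneway_outputs_unique[OF out[of x z]] out[of y z] that by (simp add: input_pairs_def)
  have "inj_on A {x. length x = n}"
  proof (rule inj_onI, rule ccontr)
    fix x y :: bits
    assume "x \<in> {x. length x = n}" "y \<in> {x. length x = n}" "A x = A y" "x \<noteq> y"
    then show False
      using eq[of x y x] eq[of x y y] exceeds_linear[of x y] exceeds_irrefl by auto
  qed
  then have "card {x :: bits. length x = n} \<le> card {x :: bits. length x = s}"
    using A finite_bits by (intro card_inj_on_le) auto
  then show ?thesis
    by (simp add: card_bits)
qed

text \<open>Strings \<open>y\<close> and \<open>z\<close> with the same table would have equal
  columns, but rows \<open>y\<close> and \<open>z\<close> tell these columns apart: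
  \<open>exceeds\<close> is False on the diagonal and True at \<open>(y, z)\<close> or
  \<open>(z, y)\<close>. Restriction to messages of length \<open>s\<close> leaves finitely many
  tables. The set \<open>B\<close> of replies is kept general to serve both models with
  memory.\<close>

lemma card_columns_le:
  fixes g :: "bits \<Rightarrow> bits \<Rightarrow> 'b"
  assumes "finite B" and "\<And>y m. length m = s \<Longrightarrow> g y m \<in> B"
    and eq: "\<And>y z x. \<lbrakk>\<And>m. length m = s \<Longrightarrow> g y m = g z m; length y = n; length z = n; length x = n\<rbrakk>
      \<Longrightarrow> exceeds x y = exceeds x z"
  shows "2 ^ n \<le> card B ^ (2 ^ s)"
proof -
  let ?S = "{m :: bits. length m = s}"
  have "inj_on (\<lambda>y. restrict (g y) ?S) {y. length y = n}"
  proof (rule inj_onI, rule ccontr)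
    fix y z :: bits
    assume yz: "y \<in> {y. length y = n}" "z \<in> {y. length y = n}"
      and res: "restrict (g y) ?S = restrict (g z) ?S" and "y \<noteq> z"
    have "g y m = g z m" if "length m = s" for m
      using fun_cong[OF res, of m] that by simp
    then show False
      using yz eq[of y z y] eq[of y z z] exceeds_linear[OF \<open>y \<noteq> z\<close>] exceeds_irrefl by auto
  qed
  then have "card {y :: bits. length y = n} \<le> card (PiE ?S (\<lambda>_. B))"
  proof (rule card_inj_on_le)
    show "(\<lambda>y. restrict (g y) ?S) ` {y. length y = n} \<subseteq> PiE ?S (\<lambda>_. B)"
      using assms(2) by (intro image_subsetI) (simp add: restrict_PiE_iff)
    show "finite (PiE ?S (\<lambda>_. B))"
      using assms(1) finite_bits by (intro finite_PiE) auto
  qed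
  then show ?thesis
    by (simp add: card_PiE card_bits finite_bits)
qed

lemma M_oneway_lower_bound:
  assumes "M_oneway_computable s (input_pairs n) exceeds"
  shows "n \<le> 2 * 2 ^ s"
proof -
  obtain A g where A: "\<And>x h. length (A x h) = s"
    and out: "\<And>x y. (x, y) \<in> input_pairs n \<Longrightarrow> oneway_outputs (A x) (g y) (exceeds x y)"
    using assms unfolding M_oneway_computable_def by blast
  have "2 ^ n \<le> card (UNIV :: bool option set) ^ (2 ^ s)"
  proof (rule card_columns_le[of _ _ g])
    fix y z x :: bits
    assume eq: "\<And>m. length m = s \<Longrightarrow> g y m = g z m"
      and len: "length y = n" "length z = n" "length x = n"
    show "exceeds x y = exceeds x z"
      using oneway_outputs_cong[of "A x" s "g y" "g z", OF A eq] out[of x y] out[of x z] len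
        oneway_outputs_unique by (auto simp: input_pairs_def)
  qed auto
  also have "card (UNIV :: bool option set) = 3"
    by (simp add: UNIV_option_conv card_image)
  \<comment> \<open>Rounding 3 up to a power of 2 allows the exponents to be compared.\<close>
  also have "(3 :: nat) ^ (2 ^ s) \<le> (2 ^ 2) ^ (2 ^ s)"
    by (intro power_mono) auto
  finally have "(2 :: nat) ^ n \<le> 2 ^ (2 * 2 ^ s)"
    by (simp only: power_mult)
  then show ?thesis
    by simp
qed

lemma M_twoway_lower_bound:
  assumes "M_twoway_computable s (input_pairs n) exceeds"
  shows "n \<le> s * 2 ^ s"
proof -
  obtain A g where A: "\<And>x h. length (A x h) = s"
    and g: "\<And>y m. length m = s \<Longrightarrow> length (g y m) = s"
    and out: "\<And>x y. (x, y) \<in> input_pairs n \<Longrightarrow> twoway_outputs s (A x) (g y) (exceeds x y)"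
    using assms unfolding M_twoway_computable_def by blast
  have "2 ^ n \<le> card {m :: bits. length m = s} ^ (2 ^ s)"
  proof (rule card_columns_le[of _ _ g])
    fix y z x :: bits
    assume eq: "\<And>m. length m = s \<Longrightarrow> g y m = g z m"
      and len: "length y = n" "length z = n" "length x = n"
    show "exceeds x y = exceeds x z"
      using twoway_outputs_cong[of "A x" s "g y" "g z", OF A g eq] out[of x y] out[of x z] len
        twoway_outputs_unique by (auto simp: input_pairs_def)
  qed (auto simp: finite_bits g)
  then show ?thesis
    by (simp add: card_bits power_mult[symmetric])
qed

section \<open>Classical protocols sending the whole input\<close>

text \<open>The models require messages of length \<open>s\<close> on every input of Alice, also on
  those outside the domain.\<close>

definition pad :: "nat \<Rightarrow> bits \<Rightarrow> bits" where
  "pad n x = take n (x @ replicate n False)"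

lemma length_pad: "length (pad n x) = n"
  by (simp add: pad_def)

lemma pad_eq: "length x = n \<Longrightarrow> pad n x = x"
  by (simp add: pad_def)

text \<open>Some correct protocol must exist for the \<open>LEAST\<close> in the complexity to be
  attained; only then does the lower bound apply to it.\<close>

lemma NM_oneway_computable_input_pairs: "NM_oneway_computable n (input_pairs n) F"
  unfolding NM_oneway_computable_def
  by (rule exI[of _ "pad n"], rule exI[of _ "\<lambda>y m. Some (F m y)"])
    (auto simp: input_pairs_def length_pad pad_eq oneway_outputs_def oneway_message_def
      intro: exI[of _ 0])

lemma M_oneway_computable_if_NM:
  "NM_oneway_computable s D F \<Longrightarrow> M_oneway_computable s D F"
  unfolding NM_oneway_computable_def M_oneway_computable_def
  by (elim exE conjE, rule_tac x = "\<lambda>x h. A x" in exI) auto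

text \<open>The leading \<open>False\<close> keeps Alice's message apart from the stop messages, the padding to length
  \<open>n + 2\<close> makes this work for \<open>n = 0\<close>.\<close>

lemma M_twoway_computable_input_pairs: "M_twoway_computable (n + 2) (input_pairs n) F"
proof -
  define A where "A = (\<lambda>x (h :: bits list). False # pad (n + 1) x)"
  define g where "g = (\<lambda>y (m :: bits). stop_message (n + 2) (F (take n (tl m)) y))"
  have "twoway_outputs (n + 2) (A x) (g y) (F x y)" if "length x = n" for x y
  proof -
    have "take n (pad (n + 1) x) = x"
      using that by (simp add: pad_def)
    then have "twoway_message (A x) (g y) 1 = stop_message (n + 2) (F x y)"
      by (simp add: twoway_message_def A_def g_def)
    moreover have "twoway_message (A x) (g y) 0 \<noteq> stop_message (n + 2) c" for c
      by (simp add: twoway_message_def A_def stop_message_def)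
    ultimately show ?thesis
      unfolding twoway_outputs_def by (intro exI[of _ 1]) simp
  qed
  then show ?thesis
    unfolding M_twoway_computable_def
    by (intro conjI exI[of _ A] exI[of _ g])
      (auto simp: input_pairs_def A_def g_def length_pad stop_message_def)
qed

section \<open>Classical randomness as a quantum operation\<close>

text \<open>Classical distributions as density matrices. Both protocols keep every state diagonal,
  so only real weights have to be followed.\<close>

definition diag :: "nat \<Rightarrow> (nat \<Rightarrow> real) \<Rightarrow> complex mat" where
  "diag n v = mat n n (\<lambda>(i, j). if i = j then complex_of_real (v i) else 0)"

text \<open>A triple \<open>(i, j, w)\<close> stands for a transition from state \<open>j\<close> to state \<open>i\<close> of probability \<open>w\<close>.\<close>

definition transition :: "nat \<Rightarrow> nat \<Rightarrow> nat \<times> nat \<times> real \<Rightarrow> complex mat" where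
  "transition r c = (\<lambda>(i, j, w). mat r c (\<lambda>(k, l). if k = i \<and> l = j then complex_of_real (sqrt w) else 0))"

definition valid_transitions :: "nat \<Rightarrow> nat \<Rightarrow> (nat \<times> nat \<times> real) list \<Rightarrow> bool" where
  "valid_transitions r c ws \<longleftrightarrow> (\<forall>(i, j, w) \<in> set ws. i < r \<and> j < c \<and> 0 \<le> w)"

lemma mat_adjoint_index:
  "i < dim_col A \<Longrightarrow> j < dim_row A \<Longrightarrow> mat_adjoint A $$ (i, j) = cnj (A $$ (j, i))"
  by (simp add: mat_adjoint_def mat_of_rows_index)

lemma mat_adjoint_dim: "dim_row (mat_adjoint A) = dim_col A" "dim_col (mat_adjoint A) = dim_row A"
  by (simp_all add: mat_adjoint_def)

lemma transition_dim: "dim_row (transition r c t) = r" "dim_col (transition r c t) = c"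
  by (simp_all add: transition_def split: prod.splits)

lemma of_real_sqrt_mult_self:
  "0 \<le> w \<Longrightarrow> complex_of_real (sqrt w) * complex_of_real (sqrt w) = complex_of_real w"
  by (simp flip: of_real_mult)

text \<open>The Kraus operator is \<open>sqrt w\<close> times a matrix unit, and it enters twice: it
  moves the weight of \<open>j\<close> to \<open>i\<close> with factor \<open>w\<close> and creates
  no off-diagonal entry.\<close>

lemma transition_sandwich:
  assumes "i < r" "j < c" "0 \<le> w"
  shows "transition r c (i, j, w) * diag c v * mat_adjoint (transition r c (i, j, w)) =
    diag r (\<lambda>k. if k = i then w * v j else 0)" (is "?K * ?D * _ = _")
proof (rule eq_matI)
  have KD: "(?K * ?D) $$ (k, l) = (if k = i \<and> l = j then complex_of_real (sqrt w * v j) else 0)"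
    if "k < r" "l < c" for k l
  proof -
    have "(?K * ?D) $$ (k, l) = (\<Sum>x<c. ?K $$ (k, x) * ?D $$ (x, l))"
      using that by (simp add: transition_def diag_def scalar_prod_def atLeast0LessThan)
    also have "\<dots> = (\<Sum>x<c. if x = l then ?K $$ (k, l) * complex_of_real (v l) else 0)"
      using that by (intro sum.cong) (auto simp: diag_def)
    also have "\<dots> = ?K $$ (k, l) * complex_of_real (v l)"
      using that by simp
    finally show ?thesis
      using that by (simp add: transition_def)
  qed
  fix k l
  assume "k < dim_row (diag r (\<lambda>k. if k = i then w * v j else 0))"
    "l < dim_col (diag r (\<lambda>k. if k = i then w * v j else 0))"
  then have kl: "k < r" "l < r"
    by (simp_all add: diag_def)
  have "(?K * ?D * mat_adjoint ?K) $$ (k, l) = (\<Sum>x<c. (?K * ?D) $$ (k, x) * mat_adjoint ?K $$ (x, l))"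
    using kl by (simp add: transition_dim mat_adjoint_dim diag_def scalar_prod_def atLeast0LessThan)
  also have "\<dots> = (\<Sum>x<c. if x = j then (if k = i \<and> l = i then complex_of_real (w * v j) else 0) else 0)"
    using kl assms of_real_sqrt_mult_self[OF assms(3)]
    by (intro sum.cong) (auto simp: KD mat_adjoint_index transition_dim, auto simp: transition_def)
  also have "\<dots> = diag r (\<lambda>k. if k = i then w * v j else 0) $$ (k, l)"
    using kl assms by (auto simp: diag_def)
  finally show "(?K * ?D * mat_adjoint ?K) $$ (k, l) = diag r (\<lambda>k. if k = i then w * v j else 0) $$ (k, l)" .
qed (simp_all add: transition_dim mat_adjoint_dim diag_def)

lemma transition_gram:
  assumes "i < r" "j < c" "0 \<le> w"
  shows "mat_adjoint (transition r c (i, j, w)) * transition r c (i, j, w) =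
    diag c (\<lambda>l. if l = j then w else 0)" (is "_ * ?K = _")
proof (rule eq_matI)
  fix k l
  assume "k < dim_row (diag c (\<lambda>l. if l = j then w else 0))"
    "l < dim_col (diag c (\<lambda>l. if l = j then w else 0))"
  then have kl: "k < c" "l < c"
    by (simp_all add: diag_def)
  have "(mat_adjoint ?K * ?K) $$ (k, l) = (\<Sum>x<r. mat_adjoint ?K $$ (k, x) * ?K $$ (x, l))"
    using kl by (simp add: transition_dim mat_adjoint_dim scalar_prod_def atLeast0LessThan)
  also have "\<dots> = (\<Sum>x<r. if x = i then (if k = j \<and> l = j then complex_of_real w else 0) else 0)"
    using kl assms of_real_sqrt_mult_self[OF assms(3)]
    by (intro sum.cong) (auto simp: mat_adjoint_index transition_dim, auto simp: transition_def)
  also have "\<dots> = diag c (\<lambda>l. if l = j then w else 0) $$ (k, l)"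
    using kl assms by (auto simp: diag_def)
  finally show "(mat_adjoint ?K * ?K) $$ (k, l) = diag c (\<lambda>l. if l = j then w else 0) $$ (k, l)" .
qed (simp_all add: transition_dim mat_adjoint_dim diag_def)

lemma diag_add: "diag n u + diag n v = diag n (\<lambda>i. u i + v i)"
  by (rule eq_matI) (auto simp: diag_def)

lemma diag_cong: "(\<And>i. i < n \<Longrightarrow> u i = v i) \<Longrightarrow> diag n u = diag n v"
  by (rule eq_matI) (auto simp: diag_def)

lemma diag_0: "0\<^sub>m n n = diag n (\<lambda>i. 0)"
  by (rule eq_matI) (auto simp: diag_def)

lemma diag_1: "1\<^sub>m n = diag n (\<lambda>i. 1)"
  by (rule eq_matI) (auto simp: diag_def)

text \<open>On diagonal states the operation is multiplication by a nonnegative matrix; repeated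
  pairs \<open>(i, j)\<close> add up.\<close>

lemma apply_op_transitions:
  assumes "valid_transitions r c ws"
  shows "apply_op r (map (transition r c) ws) (diag c v) =
    diag r (\<lambda>k. \<Sum>(i, j, w)\<leftarrow>ws. if k = i then w * v j else 0)"
  using assms
proof (induction ws)
  case Nil
  then show ?case
    by (simp add: apply_op_def diag_0)
next
  case (Cons t ws)
  obtain i j w where t: "t = (i, j, w)"
    by (cases t)
  have "apply_op r (map (transition r c) (t # ws)) (diag c v) =
    transition r c t * diag c v * mat_adjoint (transition r c t) +
    apply_op r (map (transition r c) ws) (diag c v)"
    by (simp add: apply_op_def)
  also have "apply_op r (map (transition r c) ws) (diag c v) =
    diag r (\<lambda>k. \<Sum>(i, j, w)\<leftarrow>ws. if k = i then w * v j else 0)"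
    using Cons by (simp add: valid_transitions_def)
  also have "transition r c t * diag c v * mat_adjoint (transition r c t) =
    diag r (\<lambda>k. if k = i then w * v j else 0)"
    unfolding t using Cons.prems t by (intro transition_sandwich) (auto simp: valid_transitions_def)
  finally show ?case
    by (simp add: t diag_add)
qed

text \<open>Each Gram matrix is diagonal, so completeness only asks that the probabilities leaving
  each state sum to 1.\<close>

lemma quantum_channel_transitions:
  assumes "valid_transitions r c ws"
    and "\<And>l. l < c \<Longrightarrow> (\<Sum>(i, j, w)\<leftarrow>ws. if l = j then w else 0) = 1"
  shows "quantum_channel c r (map (transition r c) ws)"
proof -
  have "foldr (+) (map (\<lambda>K. mat_adjoint K * K) (map (transition r c) ws)) (0\<^sub>m c c) =
    diag c (\<lambda>l. \<Sum>(i, j, w)\<leftarrow>ws. if l = j then w else 0)"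
    using assms(1)
  proof (induction ws)
    case Nil
    then show ?case
      by (simp add: diag_0)
  next
    case (Cons t ws)
    obtain i j w where t: "t = (i, j, w)"
      by (cases t)
    have "mat_adjoint (transition r c t) * transition r c t = diag c (\<lambda>l. if l = j then w else 0)"
      unfolding t using Cons.prems t by (intro transition_gram) (auto simp: valid_transitions_def)
    with Cons show ?case
      by (simp add: t diag_add valid_transitions_def)
  qed
  also have "\<dots> = 1\<^sub>m c"
    unfolding diag_1 by (rule diag_cong) (rule assms(2))
  finally show ?thesis
    by (auto simp: quantum_channel_def transition_dim intro!: carrier_matI)
qed

text \<open>Covers both kinds of test in the two-way model, for stopping and for continuing.\<close>

lemma apply_op_diag_projection:
  fixes P v n
  defines "Q \<equiv> mat n n (\<lambda>(i, j). if i = j \<and> P i then 1 else 0)"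
  shows "apply_op n [Q] (diag n v) = diag n (\<lambda>i. if P i then v i else 0)"
proof -
  have Q: "Q = diag n (\<lambda>i. if P i then 1 else 0)"
    by (rule eq_matI) (auto simp: Q_def diag_def)
  have mult: "diag n u * diag n u' = diag n (\<lambda>i. u i * u' i)" for u u'
  proof (rule eq_matI)
    fix i j
    assume "i < dim_row (diag n (\<lambda>i. u i * u' i))" "j < dim_col (diag n (\<lambda>i. u i * u' i))"
    then have ij: "i < n" "j < n"
      by (simp_all add: diag_def)
    then have "(diag n u * diag n u') $$ (i, j) = (\<Sum>k<n. diag n u $$ (i, k) * diag n u' $$ (k, j))"
      by (simp add: diag_def scalar_prod_def atLeast0LessThan)
    also have "\<dots> = (\<Sum>k<n. if k = i then diag n (\<lambda>i. u i * u' i) $$ (i, j) else 0)"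
      using ij by (intro sum.cong) (auto simp: diag_def)
    finally show "(diag n u * diag n u') $$ (i, j) = diag n (\<lambda>i. u i * u' i) $$ (i, j)"
      using ij by simp
  qed (simp_all add: diag_def)
  have "mat_adjoint (diag n u) = diag n u" for u
    by (rule eq_matI) (auto simp: mat_adjoint_index mat_adjoint_dim diag_def)
  then show ?thesis
    unfolding Q apply_op_def by (simp add: mult diag_0 diag_add) (rule diag_cong, simp)
qed

lemma mat_trace_diag: "mat_trace (diag n v) = complex_of_real (\<Sum>i<n. v i)"
  by (simp add: mat_trace_def diag_def)

text \<open>Both protocols use a memory of dimension 1, so the tensor factor disappears.\<close>

lemma on_message_1: "on_message 1 Ks = Ks"
proof -
  have "kron (1\<^sub>m 1) K = K" for K
    by (rule eq_matI) (auto simp: kron_def)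
  then show ?thesis
    by (simp add: on_message_def map_idI)
qed

section \<open>The quantum protocols\<close>

definition alice_prob :: "bits \<Rightarrow> real" where
  "alice_prob x = 4 ^ to_nat x / (1 + 4 ^ to_nat x)"

definition bob_prob :: "bits \<Rightarrow> real" where
  "bob_prob y = 1 / (2 * 4 ^ to_nat y)"

text \<open>The probability that a round, once reached, ends with output \<open>b\<close>. The
  values for both \<open>b\<close> together with \<open>continue_rate\<close> sum to 1.\<close>

definition correct_rate :: "bits \<Rightarrow> bits \<Rightarrow> bool \<Rightarrow> real" where
  "correct_rate x y b = (if b then alice_prob x * bob_prob y else 1 - alice_prob x)"

definition continue_rate :: "bits \<Rightarrow> bits \<Rightarrow> real" where
  "continue_rate x y = alice_prob x * (1 - bob_prob y)"

lemma alice_prob_bounds: "0 < alice_prob x" "alice_prob x < 1"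
proof -
  have "(0 :: real) < 4 ^ to_nat x" "(0 :: real) < 1 + 4 ^ to_nat x"
    by (simp_all add: add_pos_pos)
  then show "0 < alice_prob x" "alice_prob x < 1"
    unfolding alice_prob_def by simp_all
qed

lemma bob_prob_bounds: "0 < bob_prob y" "bob_prob y < 1"
proof -
  have "(1 :: real) \<le> 4 ^ to_nat y"
    by simp
  then have "(1 :: real) < 2 * 4 ^ to_nat y"
    by linarith
  then show "0 < bob_prob y" "bob_prob y < 1"
    unfolding bob_prob_def by simp_all
qed

text \<open>The rounds are independent repetitions, so the success probability is a geometric
  series: the rate of the correct output over the total rate of stopping. It is at least 2/3 when
  the odds for the correct output are at least 2.\<close>

lemma success_probability:
  "\<exists>p\<ge>2/3. (\<lambda>t. correct_rate x y (exceeds x y) * continue_rate x y ^ t) sums p"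
proof (intro exI conjI)
  let ?p = "alice_prob x" and ?r = "bob_prob y" and ?c = "correct_rate x y (exceeds x y)"
  note bounds = alice_prob_bounds[of x] bob_prob_bounds[of y]
  have q: "0 \<le> continue_rate x y"
    using bounds by (simp add: continue_rate_def)
  \<comment> \<open>The total probability of stopping in one round; its positivity makes the series
    converge.\<close>
  have "1 - continue_rate x y = (1 - ?p) + ?p * ?r"
    by (simp add: continue_rate_def algebra_simps)
  moreover have "0 < ?p * ?r"
    using bounds by simp
  ultimately have q1: "continue_rate x y < 1"
    using bounds by linarith
  show "(\<lambda>t. ?c * continue_rate x y ^ t) sums (?c * (1 / (1 - continue_rate x y)))"
    using q q1 by (intro sums_mult geometric_sums) simp
  \<comment> \<open>The odds of output True against False, cleared of denominators.\<close>
  have odds: "?p * ?r * (2 * 4 ^ to_nat y) = (1 - ?p) * 4 ^ to_nat x"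
  proof -
    have "1 - ?p = 1 / (1 + 4 ^ to_nat x)"
      using add_pos_pos[of "1 :: real" "4 ^ to_nat x"] by (simp add: alice_prob_def field_simps)
    then show ?thesis
      by (simp add: alice_prob_def bob_prob_def)
  qed
  have "2 * (1 - continue_rate x y) \<le> 3 * ?c"
  proof (cases "exceeds x y")
    case True
    then have "Suc (to_nat y) \<le> to_nat x"
      by (simp add: exceeds_def)
    \<comment> \<open>A gap of one in the numbering gives a factor 4; the 2 in
      \<open>bob_prob\<close> leaves odds of at least 2.\<close>
    then have "(4 :: real) ^ Suc (to_nat y) \<le> 4 ^ to_nat x"
      by (intro power_increasing) auto
    then have "(1 - ?p) * (4 * 4 ^ to_nat y) \<le> ?p * ?r * (2 * 4 ^ to_nat y)"
      unfolding odds using bounds by (intro mult_left_mono) auto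
    then have "(2 * (1 - ?p)) * (2 * 4 ^ to_nat y) \<le> ?p * ?r * (2 * 4 ^ to_nat y)"
      by simp
    then have "2 * (1 - ?p) \<le> ?p * ?r"
      by (rule mult_right_le_imp_le) simp
    with True show ?thesis
      by (simp add: correct_rate_def continue_rate_def algebra_simps)
  next
    case False
    then have "to_nat x \<le> to_nat y"
      by (simp add: exceeds_def)
    \<comment> \<open>Equality is included here, and it is the 2 in \<open>bob_prob\<close> that
      then tips the odds towards False.\<close>
    then have "(4 :: real) ^ to_nat x \<le> 4 ^ to_nat y"
      by (intro power_increasing) auto
    then have "?p * ?r * (2 * 4 ^ to_nat y) \<le> (1 - ?p) * 4 ^ to_nat y"
      unfolding odds using bounds by (intro mult_left_mono) auto
    then have "(2 * (?p * ?r)) * 4 ^ to_nat y \<le> (1 - ?p) * 4 ^ to_nat y"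
      by simp
    then have "2 * (?p * ?r) \<le> 1 - ?p"
      by (rule mult_right_le_imp_le) simp
    with False show ?thesis
      by (simp add: correct_rate_def continue_rate_def algebra_simps)
  qed
  then show "2 / 3 \<le> ?c * (1 / (1 - continue_rate x y))"
    using q1 by (simp add: field_simps)
qed

subsection \<open>One-way\<close>

definition oneway_A :: "bits \<Rightarrow> complex mat list" where
  "oneway_A x = map (transition 2 1) [(0, 0, 1 - alice_prob x), (1, 0, alice_prob x)]"

text \<open>The output system has dimension 1, so every transition ends in state 0; the outcome is
  recorded by the choice of the list.\<close>

definition oneway_B :: "bits \<Rightarrow> bool option \<Rightarrow> complex mat list" where
  "oneway_B y z = map (transition 1 2)
     [case z of None \<Rightarrow> (0, 1, 1 - bob_prob y) | Some False \<Rightarrow> (0, 0, 1)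
      | Some True \<Rightarrow> (0, 1, bob_prob y)]"

lemma oneway_A_apply:
  "apply_op 2 (oneway_A x) (diag 1 v) =
    diag 2 (\<lambda>i. v 0 * (if i = 0 then 1 - alice_prob x else alice_prob x))"
  unfolding oneway_A_def using alice_prob_bounds[of x]
  by (subst apply_op_transitions)
    (auto simp: valid_transitions_def less_2_cases_iff intro!: diag_cong)

lemma oneway_B_apply:
  "apply_op 1 (oneway_B y z) (diag 2 v) =
    diag 1 (\<lambda>i. case z of None \<Rightarrow> (1 - bob_prob y) * v 1 | Some False \<Rightarrow> v 0
      | Some True \<Rightarrow> bob_prob y * v 1)"
  unfolding oneway_B_def using bob_prob_bounds[of y]
  by (subst apply_op_transitions)
    (auto simp: valid_transitions_def split: option.splits bool.splits intro!: diag_cong)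

text \<open>Each round sends the same distribution, scaled by the probability that the round is
  reached.\<close>

lemma oneway_state_eq:
  "oneway_state 1 (\<lambda>t. 1) (\<lambda>t. oneway_A x) (oneway_B y) t =
    diag 2 (\<lambda>i. continue_rate x y ^ t * (if i = 0 then 1 - alice_prob x else alice_prob x))"
proof (induction t)
  case 0
  show ?case
    by (simp add: diag_1 oneway_A_apply[unfolded One_nat_def])
next
  case (Suc t)
  then show ?case
    unfolding oneway_state.simps Suc on_message_1 oneway_B_apply mult_1 power_one_right oneway_A_apply
    by (simp add: continue_rate_def ac_simps)
qed

lemma oneway_stop_prob_eq:
  "oneway_stop_prob 1 (\<lambda>t. 1) (\<lambda>t. oneway_A x) (oneway_B y) b =
    (\<lambda>t. correct_rate x y b * continue_rate x y ^ t)"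
  unfolding oneway_stop_prob_def fun_eq_iff oneway_state_eq on_message_1 oneway_B_apply mat_trace_diag
  by (cases b) (simp_all add: correct_rate_def)

lemma QNM_oneway_computable_exceeds: "QNM_oneway_computable 1 D exceeds"
proof -
  have "quantum_channel 1 (2 ^ 1) (oneway_A x)" for x
    using alice_prob_bounds[of x] unfolding oneway_A_def power_one_right
    by (intro quantum_channel_transitions) (auto simp: valid_transitions_def)
  moreover have "oneway_bob 1 (oneway_B y)" for y
  proof -
    have "oneway_B y None @ oneway_B y (Some False) @ oneway_B y (Some True) =
      map (transition 1 2) [(0, 1, 1 - bob_prob y), (0, 0, 1), (0, 1, bob_prob y)]"
      by (simp add: oneway_B_def)
    moreover have "quantum_channel 2 1
      (map (transition 1 2) [(0, 1, 1 - bob_prob y), (0, 0, 1), (0, 1, bob_prob y)])"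
      using bob_prob_bounds[of y]
      by (intro quantum_channel_transitions) (auto simp: valid_transitions_def less_2_cases_iff)
    ultimately show ?thesis
      by (simp only: oneway_bob_def power_one_right)
  qed
  ultimately show ?thesis
    unfolding QNM_oneway_computable_def
    by (intro exI[of _ oneway_A] exI[of _ oneway_B] conjI)
      (auto simp only: oneway_stop_prob_eq success_probability)
qed

lemma QM_oneway_computable_if_QNM:
  assumes "QNM_oneway_computable m D F"
  shows "QM_oneway_computable m D F"
proof -
  obtain A B where "\<forall>x. quantum_channel 1 (2 ^ m) (A x)" "\<forall>y. oneway_bob m (B y)"
    "\<forall>(x, y)\<in>D. \<exists>p\<ge>2/3. oneway_stop_prob m (\<lambda>t. 1) (\<lambda>t. A x) (B y) (F x y) sums p"
    using assms unfolding QNM_oneway_computable_def by blast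
  then show ?thesis
    unfolding QM_oneway_computable_def oneway_alice_def
    by (intro exI[of _ "\<lambda>x t. 1"] exI[of _ "\<lambda>x t. A x"] exI[of _ B]) simp
qed

subsection \<open>Two-way\<close>

text \<open>With two qubits the basis states 2 and 3 stop the protocol with outputs False and True; the
  transitions from them only complete the channels.\<close>

definition twoway_A :: "bits \<Rightarrow> nat \<Rightarrow> complex mat list" where
  "twoway_A x t =
     (if t = 0 then map (transition 4 1) [(0, 0, 1 - alice_prob x), (1, 0, alice_prob x)]
      else map (transition 4 4)
        [(0, 0, 1 - alice_prob x), (1, 0, alice_prob x), (0, 1, 1 - alice_prob x),
         (1, 1, alice_prob x), (0, 2, 1 - alice_prob x), (1, 2, alice_prob x),
         (0, 3, 1 - alice_prob x), (1, 3, alice_prob x)])"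

definition twoway_B :: "bits \<Rightarrow> complex mat list" where
  "twoway_B y = map (transition 4 4)
     [(2, 0, 1), (3, 1, bob_prob y), (0, 1, 1 - bob_prob y), (2, 2, 1), (3, 3, 1)]"

lemma less_4_cases: "i < (4 :: nat) \<longleftrightarrow> i = 0 \<or> i = 1 \<or> i = 2 \<or> i = 3"
  by auto

definition alice_dist :: "bits \<Rightarrow> nat \<Rightarrow> real" where
  "alice_dist x i = (if i = 0 then 1 - alice_prob x else if i = 1 then alice_prob x else 0)"

text \<open>The law of Bob's reply to a message distributed as \<open>alice_dist x\<close>. Reply 0
  asks for another round; replies 2 and 3 stop with False and True.\<close>

definition reply_dist :: "bits \<Rightarrow> bits \<Rightarrow> nat \<Rightarrow> real" where
  "reply_dist x y i = (if i = 0 then continue_rate x y else if i = 1 then 0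
     else if i = 2 then 1 - alice_prob x else alice_prob x * bob_prob y)"

lemma twoway_A_0_apply:
  "apply_op 4 (twoway_A x 0) (diag 1 (\<lambda>i. 1)) = diag 4 (alice_dist x)"
  unfolding twoway_A_def if_P[OF refl] using alice_prob_bounds[of x]
  by (subst apply_op_transitions)
    (auto simp: valid_transitions_def alice_dist_def intro!: diag_cong)

text \<open>Alice ignores Bob's reply and draws a fresh bit, so only the total weight
  survives.\<close>

lemma twoway_A_Suc_apply:
  "apply_op 4 (twoway_A x (Suc t)) (diag 4 v) =
    diag 4 (\<lambda>i. (v 0 + v 1 + v 2 + v 3) * alice_dist x i)"
  unfolding twoway_A_def if_not_P[OF nat.simps(3)] using alice_prob_bounds[of x]
  by (subst apply_op_transitions)
    (auto simp: valid_transitions_def alice_dist_def algebra_simps intro!: diag_cong)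

text \<open>States 2 and 3 have no weight in \<open>alice_dist x\<close>, so the transitions that
  complete the channel contribute nothing. The factor \<open>c\<close> will be the probability of
  reaching the round.\<close>

lemma twoway_B_apply:
  "apply_op 4 (twoway_B y) (diag 4 (\<lambda>i. c * alice_dist x i)) = diag 4 (\<lambda>i. c * reply_dist x y i)"
  unfolding twoway_B_def using bob_prob_bounds[of y]
  by (subst apply_op_transitions)
    (auto simp: valid_transitions_def alice_dist_def reply_dist_def continue_rate_def less_4_cases
      intro!: diag_cong)

lemma twoway_continue_diag:
  "twoway_continue 2 1 (diag 4 v) = diag 4 (\<lambda>i. if i < 2 then v i else 0)"
  using apply_op_diag_projection[of 4 "\<lambda>i. i < 2" v]
  by (simp add: twoway_continue_def on_message_1[unfolded One_nat_def] continue_proj_def)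

lemma stop_proj_diag:
  "Re (mat_trace (apply_op 4 [stop_proj 2 b] (diag 4 v))) = v (2 + of_bool b)"
  using apply_op_diag_projection[of 4 "\<lambda>i. i = 2 + of_bool b" v]
  by (cases b) (simp_all add: stop_proj_def mat_trace_diag)

text \<open>Messages \<open>2 * t\<close> and \<open>2 * t + 1\<close> form round \<open>t\<close>
  and share the factor \<open>continue_rate x y ^ t\<close>.\<close>

lemma twoway_state_eq:
  "twoway_state 2 (\<lambda>t. 1) (twoway_A x) (twoway_B y) k =
    diag 4 (\<lambda>i. continue_rate x y ^ (k div 2) *
      (if even k then alice_dist x i else reply_dist x y i))"
proof (induction k)
  case 0
  show ?case
    using twoway_A_0_apply by (simp add: diag_1)
next
  case (Suc k)
  let ?q = "continue_rate x y"
  show ?case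
  proof (cases "even k")
    case True
    have "twoway_state 2 (\<lambda>t. 1) (twoway_A x) (twoway_B y) (Suc k) =
      apply_op 4 (twoway_B y) (twoway_continue 2 1 (diag 4 (\<lambda>i. ?q ^ (k div 2) * alice_dist x i)))"
      using Suc True by (simp add: on_message_1[unfolded One_nat_def])
    \<comment> \<open>Alice's messages live on states 0 and 1, so the test removes nothing.\<close>
    also have "twoway_continue 2 1 (diag 4 (\<lambda>i. ?q ^ (k div 2) * alice_dist x i)) =
      diag 4 (\<lambda>i. ?q ^ (k div 2) * alice_dist x i)"
      unfolding twoway_continue_diag by (rule diag_cong) (simp add: alice_dist_def)
    finally show ?thesis
      using True by (simp add: twoway_B_apply)
  next
    case False
    then have k: "Suc k div 2 = Suc (k div 2)"
      by simp
    have "twoway_state 2 (\<lambda>t. 1) (twoway_A x) (twoway_B y) (Suc k) =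
      apply_op 4 (twoway_A x (Suc (k div 2)))
        (twoway_continue 2 1 (diag 4 (\<lambda>i. ?q ^ (k div 2) * reply_dist x y i)))"
      using Suc False k by simp
    \<comment> \<open>Of Bob's reply the test leaves only state 0, whose weight is the new factor
      \<open>continue_rate x y\<close>.\<close>
    also have "\<dots> = diag 4 (\<lambda>i. ?q ^ Suc (k div 2) * alice_dist x i)"
      unfolding twoway_continue_diag twoway_A_Suc_apply
      by (simp add: reply_dist_def ac_simps)
    finally show ?thesis
      using False k by simp
  qed
qed

text \<open>Only Bob's messages stop the protocol. The index \<open>(k - 1) div 2\<close> is the
  shape in which \<open>sums_if'\<close> interleaves a series with zeros.\<close>

lemma twoway_stop_prob_eq:
  "twoway_stop_prob 2 (\<lambda>t. 1) (twoway_A x) (twoway_B y) b k =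
    (if even k then 0 else correct_rate x y b * continue_rate x y ^ ((k - 1) div 2))"
proof -
  have "twoway_stop_prob 2 (\<lambda>t. 1) (twoway_A x) (twoway_B y) b k =
    Re (mat_trace (apply_op 4 [stop_proj 2 b] (diag 4 (\<lambda>i. continue_rate x y ^ (k div 2) *
      (if even k then alice_dist x i else reply_dist x y i)))))"
    by (simp add: twoway_stop_prob_def twoway_state_eq[unfolded One_nat_def]
        on_message_1[unfolded One_nat_def])
  then show ?thesis
    unfolding stop_proj_diag
    by (cases b) (auto simp: alice_dist_def reply_dist_def correct_rate_def elim: oddE)
qed

lemma QM_twoway_computable_exceeds: "QM_twoway_computable 2 D exceeds"
proof -
  have "twoway_alice 2 (\<lambda>t. 1) (twoway_A x)" for x
  proof -
    have "quantum_channel 1 4 (twoway_A x 0)"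
      unfolding twoway_A_def if_P[OF refl] using alice_prob_bounds[of x]
      by (intro quantum_channel_transitions) (auto simp: valid_transitions_def)
    moreover have "quantum_channel 4 4 (twoway_A x (Suc t))" for t
      unfolding twoway_A_def if_not_P[OF nat.simps(3)] using alice_prob_bounds[of x]
      by (intro quantum_channel_transitions) (auto simp: valid_transitions_def less_4_cases)
    ultimately show ?thesis
      by (simp add: twoway_alice_def)
  qed
  moreover have "quantum_channel (2 ^ 2) (2 ^ 2) (twoway_B y)" for y
  proof -
    have "quantum_channel 4 4 (twoway_B y)"
      unfolding twoway_B_def using bob_prob_bounds[of y]
      by (intro quantum_channel_transitions) (auto simp: valid_transitions_def less_4_cases)
    then show ?thesis
      by simp
  qed
  moreover have "\<exists>p\<ge>2/3. twoway_stop_prob 2 (\<lambda>t. 1) (twoway_A x) (twoway_B y) (exceeds x y) sums p"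
    for x y
  proof -
    obtain p where p: "p \<ge> 2/3"
      "(\<lambda>t. correct_rate x y (exceeds x y) * continue_rate x y ^ t) sums p"
      using success_probability by blast
    from p(1) sums_if'[OF p(2)] show ?thesis
      unfolding twoway_stop_prob_eq by blast
  qed
  ultimately show ?thesis
    unfolding QM_twoway_computable_def
    by (intro conjI exI[of _ "\<lambda>x t. 1"] exI[of _ twoway_A] exI[of _ twoway_B]) auto
qed

section \<open>The separations\<close>

text \<open>A bounded \<open>L\<close> suffices, since \<open>ln R\<close> is eventually at least 1
  once \<open>R\<close> tends to infinity. The function \<open>h\<close> expresses how the input
  length is bounded in terms of \<open>R\<close>.\<close>

lemma exponentially_weak_exceedsI:
  fixes h :: "nat \<Rightarrow> nat"
  assumes L: "\<And>n. L (input_pairs n) exceeds \<le> c"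
    and R: "\<And>n. n \<le> h (R (input_pairs n) exceeds)" and "mono h"
  shows "exponentially_weak L R"
proof -
  have lim: "filterlim (\<lambda>n. R (input_pairs n) exceeds) at_top sequentially"
    unfolding filterlim_at_top
  proof
    fix Z
    have "Z \<le> R (input_pairs n) exceeds" if "Suc (h Z) \<le> n" for n
    proof (rule ccontr)
      assume "\<not> Z \<le> R (input_pairs n) exceeds"
      then have "h (R (input_pairs n) exceeds) \<le> h Z"
        \<comment> \<open>A value of \<open>R\<close> below \<open>Z\<close> would force
          \<open>n\<close> to be at most \<open>h Z\<close>.\<close>
        using \<open>mono h\<close> by (simp add: monoD)
      with R[of n] that show False
        by simp
    qed
    then show "eventually (\<lambda>n. Z \<le> R (input_pairs n) exceeds) sequentially"
      using eventually_sequentially by blast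
  qed
  then have "filterlim (\<lambda>n. ln (real (R (input_pairs n) exceeds))) at_top sequentially"
    by (intro filterlim_compose[OF ln_at_top] filterlim_compose[OF filterlim_real_sequentially])
  then have "eventually (\<lambda>n. 1 \<le> ln (real (R (input_pairs n) exceeds))) sequentially"
    by (simp add: filterlim_at_top)
  then have "(\<lambda>n. real (L (input_pairs n) exceeds)) \<in>
    O[sequentially](\<lambda>n. ln (real (R (input_pairs n) exceeds)))"
  proof (intro bigoI[where c = "real c"], eventually_elim)
    case (elim n)
    have "real (L (input_pairs n) exceeds) \<le> real c * 1"
      using L[of n] by simp
    also have "\<dots> \<le> real c * ln (real (R (input_pairs n) exceeds))"
      using elim by (intro mult_left_mono) auto
    finally show ?case
      using elim by simp
  qed
  with lim show ?thesis
    unfolding exponentially_weak_def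
    by (intro exI[of _ input_pairs] exI[of _ "\<lambda>n. exceeds"]) (auto simp: input_pairs_def)
qed

theorem theorem5p2:
  shows "exponentially_weak QNM_oneway NM_oneway \<and>
         exponentially_weak QM_oneway M_oneway \<and>
         exponentially_weak QM_twoway M_twoway"
proof (intro conjI)
  show "exponentially_weak QNM_oneway NM_oneway"
  proof (rule exponentially_weak_exceedsI[where h = "\<lambda>s. s"])
    show "QNM_oneway (input_pairs n) exceeds \<le> 1" for n
      unfolding QNM_oneway_def by (intro Least_le QNM_oneway_computable_exceeds)
    show "n \<le> NM_oneway (input_pairs n) exceeds" for n
      unfolding NM_oneway_def
      by (rule NM_oneway_lower_bound, rule LeastI, rule NM_oneway_computable_input_pairs)
  qed (simp add: mono_def)
  show "exponentially_weak QM_oneway M_oneway"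
  proof (rule exponentially_weak_exceedsI[where h = "\<lambda>s. 2 * 2 ^ s"])
    show "QM_oneway (input_pairs n) exceeds \<le> 1" for n
      unfolding QM_oneway_def
      by (intro Least_le QM_oneway_computable_if_QNM QNM_oneway_computable_exceeds)
    show "n \<le> 2 * 2 ^ M_oneway (input_pairs n) exceeds" for n
      unfolding M_oneway_def
      by (rule M_oneway_lower_bound, rule LeastI, rule M_oneway_computable_if_NM[OF NM_oneway_computable_input_pairs])
  qed (simp add: mono_def)
  show "exponentially_weak QM_twoway M_twoway"
  proof (rule exponentially_weak_exceedsI[where h = "\<lambda>s. s * 2 ^ s"])
    show "QM_twoway (input_pairs n) exceeds \<le> 2" for n
      unfolding QM_twoway_def by (intro Least_le QM_twoway_computable_exceeds)
    show "n \<le> M_twoway (input_pairs n) exceeds * 2 ^ M_twoway (input_pairs n) exceeds" for n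
      unfolding M_twoway_def
      by (rule M_twoway_lower_bound, rule LeastI, rule M_twoway_computable_input_pairs)
  qed (simp add: mono_def mult_le_mono)
qed

end
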